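(* Let $n,r$ be positive integers, $d=\gcd(r,n)$, $K_r=2^{2r}-2^r+1$, and let $e$ be the least positive residue of the inverse of $\frac rd$ modulo $\frac nd$. Let $a\in\{1,\dots,2^n-2\}$ with binary expansion $a=\sum_{m=0}^{n-1}\alpha_m2^m$, and define the $d\times\frac nd$ matrix $(a_{i,j})$ by $a_{i,j}=\alpha_{(i-jr)\bmod n}$ (so $a\equiv\sum_{i,j}a_{i,j}2^{i-jr}\pmod{2^n-1}$). The following are equivalent: (a) $a$ is the inverse of $K_r$ modulo $2^n-1$; (b) there exists a $d\times\frac nd$ matrix $(c_{i,j})$ with entries in $\{-1,0,1\}$ such that $$2c_{0,0}-c_{d-1,e}+1=a_{0,2}-a_{0,1}+a_{0,0},$$ $$2c_{0,j}-c_{d-1,j+e}=a_{0,j+2}-a_{0,j+1}+a_{0,j}\quad\text{for all } j\in\{1,\dots,\tfrac nd-1\},$$ $$2c_{i,j}-c_{i-1,j}=a_{i,j+2}-a_{i,j+1}+a_{i,j}\quad\text{for all } i\in\{1,\dots,d-1\},\ j\in\{0,\dots,\tfrac nd-1\},$$ where column indices are taken modulo $\frac nd$. Moreover, the matrix $(c_{i,j})$ in (b) is unique.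
   Context: Powers $2^{m}$ with arbitrary integer $m$ are understood modulo $2^n-1$, i.e. $2^m=2^{m\bmod n}$. *)

theory Defs
  imports "HOL-Number_Theory.Cong" "Jordan_Normal_Form.Matrix"
begin

definition kasami_exponent :: "nat \<Rightarrow> int" where
  "kasami_exponent r = 2 ^ (2 * r) - 2 ^ r + 1"

text \<open>The least positive residue lies in \<open>{1..m}\<close>; in particular it is 1 (not 0) for \<open>m = 1\<close>.\<close>

definition least_pos_inverse :: "nat \<Rightarrow> nat \<Rightarrow> nat" where
  "least_pos_inverse x m = (LEAST y. 0 < y \<and> [x * y = 1] (mod m))"

text \<open>Modulo \<open>2 ^ n - 1\<close>, a power of 2 with an arbitrary integer exponent stands for the power
  with the exponent reduced modulo \<open>n\<close>.\<close>

definition exp_res :: "nat \<Rightarrow> int \<Rightarrow> nat" where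
  "exp_res n m = nat (m mod int n)"

text \<open>The \<open>d \<times> (n / d)\<close> matrix with entry \<open>\<alpha> ((i - j r) mod n)\<close> in row \<open>i\<close>, column \<open>j\<close>,
  where \<open>d = gcd r n\<close>.\<close>

definition digit_matrix :: "nat \<Rightarrow> nat \<Rightarrow> (nat \<Rightarrow> int) \<Rightarrow> int mat" where
  "digit_matrix n r \<alpha> =
     mat (gcd r n) (n div gcd r n) (\<lambda>(i, j). \<alpha> (exp_res n (int i - int j * int r)))"

text \<open>Entry of a matrix with the column index read cyclically.\<close>

definition cyc_entry :: "int mat \<Rightarrow> nat \<Rightarrow> nat \<Rightarrow> int" where
  "cyc_entry M i j = M $$ (i, j mod dim_col M)"

definition is_carry_matrix :: "nat \<Rightarrow> nat \<Rightarrow> nat \<Rightarrow> int mat \<Rightarrow> int mat \<Rightarrow> bool" where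
  "is_carry_matrix d N e A C \<longleftrightarrow>
     C \<in> carrier_mat d N \<and>
     elements_mat C \<subseteq> {-1, 0, 1} \<and>
     2 * cyc_entry C 0 0 - cyc_entry C (d - 1) e + 1
       = cyc_entry A 0 2 - cyc_entry A 0 1 + cyc_entry A 0 0 \<and>
     (\<forall>j\<in>{1..<N}. 2 * cyc_entry C 0 j - cyc_entry C (d - 1) (j + e)
       = cyc_entry A 0 (j + 2) - cyc_entry A 0 (j + 1) + cyc_entry A 0 j) \<and>
     (\<forall>i\<in>{1..<d}. \<forall>j\<in>{0..<N}. 2 * cyc_entry C i j - cyc_entry C (i - 1) j
       = cyc_entry A i (j + 2) - cyc_entry A i (j + 1) + cyc_entry A i j)"

end

theory Submission
  imports Defs
begin

text \<open>
  Identify the entry \<open>(i, j)\<close> with the residue \<open>p = i - j r\<close> modulo \<open>n\<close>. Because \<open>e r \<equiv> d\<close>, the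
  equations in (b) become one cyclic carry recurrence \<open>2 c(p) - c(p - 1) = t(p)\<close>, where
  \<open>t(p) = a(p - 2 r) - a(p - r) + a(p) - [p = 0]\<close>. With \<open>T(p)\<close> the sum of \<open>t(p + 1 + m) 2^m\<close> over
  \<open>0 \<le> m < n\<close>, its only possible periodic solution is \<open>c(p) = T(p) / (2^n - 1)\<close>, which gives
  uniqueness. This solution is integral iff \<open>2^n - 1\<close> divides \<open>T(-1)\<close>, and \<open>T(-1) \<equiv> a K - 1\<close>.
  As \<open>-2 \<le> t \<le> 2\<close> with neither bound attained everywhere (\<open>t(0) < 2\<close> and \<open>t(1) > -2\<close>), the
  quotient lies strictly between \<open>-2\<close> and \<open>2\<close>.
\<close>

section \<open>Cyclic sums\<close>

text \<open>For periodic \<open>f\<close> this is the integer whose \<open>n\<close> generalized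
  binary digits are one period of \<open>f\<close>, read upwards from position
  \<open>z\<close>.\<close>

definition cyc_sum :: "nat \<Rightarrow> (int \<Rightarrow> int) \<Rightarrow> int \<Rightarrow> int" where
  "cyc_sum n f z = (\<Sum>m<n. f (z + int m) * 2 ^ m)"

text \<open>Both sides equal the sum of \<open>f (z + m) * 2 ^ m\<close> over 0 \<le> m \<le> n,
  with either the first or the last term split off.\<close>

lemma cyc_sum_step:
  "2 * cyc_sum n f (z + 1) + f z = cyc_sum n f z + 2 ^ n * f (z + int n)"
  unfolding cyc_sum_def by (induction n) (auto simp: algebra_simps)

lemma cyc_sum_step_periodic:
  assumes "\<And>z. f (z + int n) = f z"
  shows "2 * cyc_sum n f (z + 1) - cyc_sum n f z = (2 ^ n - 1) * f z"
  using cyc_sum_step[of n f z] assms[of z] by (simp add: algebra_simps)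

text \<open>Moving the start back by one place rotates the digits, which is doubling modulo
  \<open>2 ^ n - 1\<close>.\<close>

lemma cyc_sum_shift_cong:
  assumes "\<And>z. f (z + int n) = f z"
  shows "[cyc_sum n f (z - int k) = 2 ^ k * cyc_sum n f z] (mod 2 ^ n - 1)"
proof (induction k)
  case (Suc k)
  have "[cyc_sum n f (z - int (Suc k)) = 2 * cyc_sum n f (z - int k)] (mod 2 ^ n - 1)"
  proof -
    have "z - int (Suc k) + 1 = z - int k"
      by simp
    then have "2 ^ n - 1 dvd 2 * cyc_sum n f (z - int k) - cyc_sum n f (z - int (Suc k))"
      using cyc_sum_step_periodic[of f n "z - int (Suc k)", OF assms] by (metis dvd_triv_left)
    then show ?thesis
      by (metis cong_iff_dvd_diff cong_sym)
  qed
  also have "[2 * cyc_sum n f (z - int k) = 2 * (2 ^ k * cyc_sum n f z)] (mod 2 ^ n - 1)"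
    using Suc.IH by (rule cong_scalar_left)
  finally show ?case by (simp add: mult.assoc)
qed simp

lemma periodic_mult:
  fixes f :: "int \<Rightarrow> 'a"
  assumes per: "\<And>z. f (z + n) = f z"
  shows "f (z + n * k) = f z"
proof (induction k rule: int_induct[where k = 0])
  case (step1 i)
  then show ?case using per[of "z + n * i"] by (simp add: algebra_simps)
next
  case (step2 i)
  then show ?case using per[of "z + n * (i - 1)"] by (simp add: algebra_simps)
qed simp

lemma periodic_cong:
  fixes f :: "int \<Rightarrow> 'a"
  assumes per: "\<And>z. f (z + n) = f z" and "[x = y] (mod n)"
  shows "f x = f y"
proof -
  obtain k where "y = x + n * k"
    using assms(2) by (metis cong_iff_lin)
  then show ?thesis using periodic_mult[of f n, OF per] by simp
qed

text \<open>Twice the sum at \<open>z + 1\<close> is congruent to the sum at \<open>z\<close>, and 2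
  is invertible modulo \<open>2 ^ n - 1\<close>, so divisibility spreads in both directions.\<close>

lemma cyc_sum_dvd:
  assumes "n > 0" and per: "\<And>z. f (z + int n) = f z"
    and dvd: "2 ^ n - 1 dvd cyc_sum n f 0"
  shows "2 ^ n - 1 dvd cyc_sum n f z"
proof -
  have cop: "coprime (2 ^ n - 1 :: int) 2"
    using \<open>n > 0\<close> by simp
  have "2 ^ n - 1 dvd 2 * cyc_sum n f (z + 1) - cyc_sum n f z" for z
    using cyc_sum_step_periodic[of f n, OF per] by simp
  then have iff: "2 ^ n - 1 dvd cyc_sum n f (z + 1) \<longleftrightarrow> 2 ^ n - 1 dvd cyc_sum n f z" for z
    using cop by (metis coprime_dvd_mult_right_iff dvd_diff_right_iff dvd_diff_left_iff
        dvd_mult)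
  show ?thesis
  proof (induction z rule: int_induct[where k = 0])
    case base
    then show ?case by (rule dvd)
  next
    case (step1 i)
    then show ?case using iff[of i] by simp
  next
    case (step2 i)
    then show ?case using iff[of "i - 1"] by simp
  qed
qed

section \<open>Cyclic carries\<close>

text \<open>Weighted by powers of 2, the recurrence telescopes; after a full period both boundary
  terms are multiples of \<open>c z\<close>.\<close>

lemma carry_unique:
  assumes per: "\<And>z. c (z + int n) = c z"
    and eq: "\<And>z. 2 * c z - c (z - 1) = t z"
  shows "(2 ^ n - 1) * c z = cyc_sum n t (z + 1)"
proof -
  \<comment> \<open>The length \<open>k\<close> is separated from the period \<open>n\<close>, which
    must stay fixed during the induction.\<close>
  have "cyc_sum k t (z + 1) = 2 ^ k * c (z + int k) - c z" for k
  proof (induction k)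
    case (Suc k)
    have "2 ^ k * t (z + 1 + int k) = 2 ^ k * (2 * c (z + 1 + int k) - c (z + int k))"
      using eq[of "z + 1 + int k"] by (simp add: algebra_simps)
    then show ?case
      using Suc.IH by (simp add: cyc_sum_def algebra_simps)
  qed (simp add: cyc_sum_def)
  then show ?thesis using per[of z] by (simp add: algebra_simps)
qed

lemma carry_exists:
  assumes "n > 0" and per: "\<And>z. t (z + int n) = t z"
    and dvd: "2 ^ n - 1 dvd cyc_sum n t 0"
  obtains c where "\<And>z. c (z + int n) = c z" "\<And>z. 2 * c z - c (z - 1) = t z"
    "\<And>z. (2 ^ n - 1) * c z = cyc_sum n t (z + 1)"
proof
  define c where "c z = cyc_sum n t (z + 1) div (2 ^ n - 1)" for z
  have pos: "(2 ^ n - 1 :: int) > 0"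
    using \<open>n > 0\<close> by simp
  show c: "(2 ^ n - 1) * c z = cyc_sum n t (z + 1)" for z
    unfolding c_def by (rule dvd_mult_div_cancel) (rule cyc_sum_dvd[OF \<open>n > 0\<close> per dvd])
  show "c (z + int n) = c z" for z
    using per unfolding c_def cyc_sum_def
    by (metis (no_types, opaque_lifting) add.assoc add.commute)
  show "2 * c z - c (z - 1) = t z" for z
  proof -
    have "(2 ^ n - 1) * (2 * c z - c (z - 1)) = (2 ^ n - 1) * t z"
      using cyc_sum_step_periodic[of t n, OF per, of z] c[of z] c[of "z - 1"]
      by (simp add: algebra_simps)
    then show ?thesis using pos by (metis less_irrefl mult_left_cancel)
  qed
qed

lemma sum_power2_int: "(\<Sum>m<n. 2 ^ m) = (2 ^ n - 1 :: int)"
  by (induction n) auto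

text \<open>One strict position \<open>u\<close> suffices: every window of \<open>n\<close>
  consecutive positions meets its residue class.\<close>

lemma cyc_sum_less:
  assumes le: "\<And>z. t z \<le> b" and less: "t u < b" and per: "\<And>z. t (z + int n) = t z"
    and "n > 0"
  shows "cyc_sum n t z < b * (2 ^ n - 1)"
proof -
  define m where "m = nat ((u - z) mod int n)"
  have m: "m < n" "[z + int m = u] (mod int n)"
    using \<open>n > 0\<close> by (auto simp: m_def nat_less_iff cong_def mod_simps)
  then have tm: "t (z + int m) < b"
    using periodic_cong[of t "int n", OF per m(2)] less by simp
  have "cyc_sum n t z < (\<Sum>m<n. b * 2 ^ m)"
    unfolding cyc_sum_def
    by (rule sum_strict_mono_ex1) (use le m tm in \<open>auto intro!: bexI[of _ m]\<close>)
  then show ?thesis by (simp add: sum_power2_int flip: sum_distrib_left)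
qed

lemma cyc_sum_greater:
  assumes "\<And>z. b \<le> t z" and "b < t u" and "\<And>z. t (z + int n) = t z" and "n > 0"
  shows "b * (2 ^ n - 1) < cyc_sum n t z"
proof -
  have "cyc_sum n (\<lambda>z. - t z) z < - b * (2 ^ n - 1)"
    by (rule cyc_sum_less[of _ _ u]) (use assms in simp_all)
  moreover have "cyc_sum n (\<lambda>z. - t z) z = - cyc_sum n t z"
    by (simp add: cyc_sum_def sum_negf)
  ultimately show ?thesis by simp
qed

section \<open>Unrolling the grid\<close>

text \<open>\<open>(i, j) \<mapsto> i - j r\<close> identifies the \<open>d \<times> N\<close> grid with the integers modulo \<open>n\<close>. Since
  \<open>e r \<equiv> d\<close> modulo \<open>n\<close>, its inverse sends \<open>z\<close> to row \<open>z mod d\<close> and column \<open>- e (z div d) mod N\<close>.\<close>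

locale cyclic_grid =
  fixes n r d N q e :: nat
  assumes n: "n = d * N" and r: "r = d * q" and d: "d > 0" and N: "N > 0"
    and e: "[int q * int e = 1] (mod int N)"
begin

lemma n_pos: "n > 0"
  using n d N by simp

definition col :: "int \<Rightarrow> nat" where
  "col z = nat (- (int e * (z div int d)) mod int N)"

definition unroll :: "int mat \<Rightarrow> int \<Rightarrow> int" where
  "unroll M z = M $$ (nat (z mod int d), col z)"

lemma col_less: "col z < N"
  using N by (simp add: col_def nat_less_iff)

lemma row_less: "nat (z mod int d) < d"
  using d by (simp add: nat_less_iff)

lemma col_add_period: "col (z + int n) = col z"
proof -
  have "(z + int n) div int d = z div int d + int N"
    using d n by simp
  then have "- (int e * ((z + int n) div int d)) = - (int e * (z div int d)) + int N * - int e"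
    by (simp add: algebra_simps)
  then show ?thesis
    by (simp only: col_def mod_mult_self2)
qed

lemma unroll_period: "unroll M (z + int n) = unroll M z"
  unfolding unroll_def col_add_period using n by simp

text \<open>Multiplying the column by \<open>- q\<close> gives \<open>z div d\<close> modulo
  \<open>N\<close>, as \<open>q\<close> and \<open>e\<close> are inverse. Scaling by
  \<open>d\<close> raises the modulus to \<open>n\<close> and turns \<open>q\<close> into
  \<open>r\<close>; adding the remainder \<open>z mod d\<close> recovers \<open>z\<close>.\<close>

lemma grid_inverse:
  "[z = int (nat (z mod int d)) - int (col z) * int r] (mod int n)"
proof -
  have "[int (col z) = - (int e * (z div int d))] (mod int N)"
    using N by (simp add: col_def cong_def)
  then have "[- int q * int (col z) = - int q * - (int e * (z div int d))] (mod int N)"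
    by (rule cong_scalar_left)
  then have "[- (int (col z) * int q) = int q * int e * (z div int d)] (mod int N)"
    by (simp add: algebra_simps)
  also have "[int q * int e * (z div int d) = 1 * (z div int d)] (mod int N)"
    using e by (rule cong_scalar_right)
  finally have "[int d * - (int (col z) * int q) = int d * (z div int d)] (mod int d * int N)"
    by (metis cong_cmult_leftI mult_1)
  then have "[z mod int d + int d * - (int (col z) * int q) = z mod int d + int d * (z div int d)]
      (mod int n)"
    unfolding n of_nat_mult by (simp only: cong_add_lcancel)
  moreover have "z mod int d + int d * (z div int d) = z"
    by simp
  moreover have "z mod int d + int d * - (int (col z) * int q) =
      int (nat (z mod int d)) - int (col z) * int r"
    using d by (simp add: r)
  ultimately show ?thesis
    by (metis cong_sym)
qed

lemma row_cong: "nat (x mod int d) = nat (y mod int d)" if "[x = y] (mod int n)"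
  using that unfolding n of_nat_mult cong_def by (metis mod_mod_cancel dvd_triv_left)

lemma col_cong: "col x = col y" if "[x = y] (mod int n)"
  by (rule periodic_cong[of col, OF col_add_period that])

lemma grid_row:
  assumes "i < d" shows "nat ((int i - int j * int r) mod int d) = i"
proof -
  have "(int i - int j * int r) mod int d = (int i + int d * - (int j * int q)) mod int d"
    by (simp add: r algebra_simps)
  also have "\<dots> = int i"
    using assms by (simp only: mod_mult_self2) simp
  finally show ?thesis by simp
qed

lemma grid_col:
  assumes "i < d" shows "col (int i - int j * int r) = j mod N"
proof -
  have "(int i - int j * int r) div int d = (int i + int d * (- (int j * int q))) div int d"
    by (simp add: r algebra_simps)
  also have "\<dots> = - (int j * int q)"
    using assms by (subst div_mult_self2) auto
  finally have "col (int i - int j * int r) = nat (int j * (int q * int e) mod int N)"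
    by (simp add: col_def algebra_simps)
  also have "int j * (int q * int e) mod int N = int (j mod N)"
    using cong_scalar_left[OF e, of "int j"] by (simp add: cong_def zmod_int)
  finally show ?thesis by simp
qed

lemma unroll_grid:
  assumes "M \<in> carrier_mat d N" "i < d"
  shows "unroll M (int i - int j * int r) = cyc_entry M i j"
  using assms by (simp add: unroll_def grid_row grid_col cyc_entry_def)

lemma unroll_grid_pred_row:
  assumes "M \<in> carrier_mat d N" "i < d" "i > 0"
  shows "unroll M (int i - int j * int r - 1) = cyc_entry M (i - 1) j"
  using unroll_grid[of M "i - 1" j] assms by (simp add: of_nat_diff algebra_simps)

text \<open>Stepping back from row 0 wraps around to the last row. Since \<open>e * r\<close> is
  congruent to \<open>d\<close>, this costs \<open>e\<close> columns, which explains the index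
  \<open>j + e\<close> in the equations of row 0.\<close>

lemma unroll_grid_pred_col:
  assumes "M \<in> carrier_mat d N"
  shows "unroll M (- (int j * int r) - 1) = cyc_entry M (d - 1) (j + e)"
proof -
  have "[int d * (int q * int e) = int d * 1] (mod int d * int N)"
    using e by (rule cong_cmult_leftI)
  then have "[int e * int r = int d] (mod int n)"
    by (simp add: n r algebra_simps)
  then have "[int e * int r + (int d - 1 - int (j + e) * int r) =
      int d + (int d - 1 - int (j + e) * int r)] (mod int n)"
    by (simp only: cong_add_rcancel)
  then have "[int d + (- (int j * int r) - 1) =
      int d + (int (d - 1) - int (j + e) * int r)] (mod int n)"
    using d by (simp add: of_nat_diff algebra_simps)
  then have "[- (int j * int r) - 1 = int (d - 1) - int (j + e) * int r] (mod int n)"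
    by (simp only: cong_add_lcancel)
  then have "unroll M (- (int j * int r) - 1) = unroll M (int (d - 1) - int (j + e) * int r)"
    by (rule periodic_cong[of "unroll M" "int n", OF unroll_period])
  then show ?thesis
    using unroll_grid[of M "d - 1" "j + e"] assms d by (simp only:)
qed

lemma unroll_inject:
  assumes "M \<in> carrier_mat d N" "M' \<in> carrier_mat d N" "unroll M = unroll M'"
  shows "M = M'"
proof (rule eq_matI)
  fix i j assume "i < dim_row M'" "j < dim_col M'"
  then show "M $$ (i, j) = M' $$ (i, j)"
    using assms unroll_grid[of M i j] unroll_grid[of M' i j] by (simp add: cyc_entry_def)
qed (use assms in auto)

definition roll :: "(int \<Rightarrow> int) \<Rightarrow> int mat" where
  "roll f = mat d N (\<lambda>(i, j). f (int i - int j * int r))"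

lemma roll_carrier: "roll f \<in> carrier_mat d N"
  by (simp add: roll_def)

lemma unroll_roll:
  assumes "\<And>z. f (z + int n) = f z"
  shows "unroll (roll f) z = f z"
proof -
  have "unroll (roll f) z = f (int (nat (z mod int d)) - int (col z) * int r)"
    using row_less[of z] col_less[of z] by (simp only: unroll_def roll_def index_mat prod.case)
  also have "\<dots> = f z"
    using periodic_cong[of f "int n", OF assms grid_inverse] by simp
  finally show ?thesis .
qed

text \<open>Injectivity of the grid map at residue 0; it confines the correction by 1 to a single
  equation.\<close>

lemma grid_origin:
  assumes "i < d" "j < N"
  shows "int n dvd int i - int j * int r \<longleftrightarrow> i = 0 \<and> j = 0"
proof
  assume dvd: "int n dvd int i - int j * int r"
  then have "[int i - int j * int r = int 0 - int 0 * int r] (mod int n)"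
    by (simp add: cong_iff_dvd_diff)
  then have "nat ((int i - int j * int r) mod int d) = nat ((int 0 - int 0 * int r) mod int d)"
    "col (int i - int j * int r) = col (int 0 - int 0 * int r)"
    by (rule row_cong, rule col_cong)
  then show "i = 0 \<and> j = 0"
    using assms d grid_row[of i j] grid_col[of i j] grid_row[of 0 0] grid_col[of 0 0] by simp
qed simp

section \<open>The carry equations as one recurrence\<close>

text \<open>Advancing one column subtracts \<open>r\<close> from the position. The indicator is the
  \<open>+ 1\<close> of the equation at the origin, moved to the right-hand side.\<close>

definition carry_target :: "int mat \<Rightarrow> int \<Rightarrow> int" where
  "carry_target A z = unroll A (z - int (2 * r)) - unroll A (z - int r) + unroll A z
     - of_bool (int n dvd z)"

lemma carry_target_period: "carry_target A (z + int n) = carry_target A z"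
  using unroll_period[of A "z - int (2 * r)"] unroll_period[of A "z - int r"] unroll_period[of A z]
  by (simp add: carry_target_def algebra_simps)

lemma carry_target_grid:
  assumes "A \<in> carrier_mat d N" "i < d" "j < N"
  shows "carry_target A (int i - int j * int r) =
    cyc_entry A i (j + 2) - cyc_entry A i (j + 1) + cyc_entry A i j - of_bool (i = 0 \<and> j = 0)"
  using assms grid_origin[of i j] unroll_grid[of A i j] unroll_grid[of A i "j + 1"]
    unroll_grid[of A i "j + 2"]
  by (simp add: carry_target_def algebra_simps)

lemma carry_equations_iff:
  assumes A: "A \<in> carrier_mat d N" and C: "C \<in> carrier_mat d N"
  shows "(\<forall>z. 2 * unroll C z - unroll C (z - 1) = carry_target A z) \<longleftrightarrow>
     2 * cyc_entry C 0 0 - cyc_entry C (d - 1) e + 1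
       = cyc_entry A 0 2 - cyc_entry A 0 1 + cyc_entry A 0 0 \<and>
     (\<forall>j\<in>{1..<N}. 2 * cyc_entry C 0 j - cyc_entry C (d - 1) (j + e)
       = cyc_entry A 0 (j + 2) - cyc_entry A 0 (j + 1) + cyc_entry A 0 j) \<and>
     (\<forall>i\<in>{1..<d}. \<forall>j\<in>{0..<N}. 2 * cyc_entry C i j - cyc_entry C (i - 1) j
       = cyc_entry A i (j + 2) - cyc_entry A i (j + 1) + cyc_entry A i j)"
    (is "(\<forall>z. ?P z) \<longleftrightarrow> ?O \<and> ?R \<and> ?I")
proof -
  have row0: "?P (int 0 - int j * int r) \<longleftrightarrow>
    2 * cyc_entry C 0 j - cyc_entry C (d - 1) (j + e) =
      cyc_entry A 0 (j + 2) - cyc_entry A 0 (j + 1) + cyc_entry A 0 j - of_bool (j = 0)"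
    if "j < N" for j
    using carry_target_grid[OF A d that] unroll_grid[OF C d, of j] unroll_grid_pred_col[OF C, of j]
    by simp
  have rows: "?P (int i - int j * int r) \<longleftrightarrow>
    2 * cyc_entry C i j - cyc_entry C (i - 1) j =
      cyc_entry A i (j + 2) - cyc_entry A i (j + 1) + cyc_entry A i j"
    if "i \<in> {1..<d}" "j < N" for i j
    using carry_target_grid[OF A, of i j] unroll_grid[OF C, of i j]
      unroll_grid_pred_row[OF C, of i j] that
    by simp
  have per: "?P (z + int n) = ?P z" for z
    using unroll_period[of C z] unroll_period[of C "z - 1"] carry_target_period[of A z]
    by (simp add: algebra_simps)
  \<comment> \<open>By \<open>grid_inverse\<close> every integer is congruent to the position of
    some cell, so periodicity reduces the claim to the cells.\<close>
  have "(\<forall>z. ?P z) \<longleftrightarrow> (\<forall>i<d. \<forall>j<N. ?P (int i - int j * int r))"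
    using periodic_cong[of ?P "int n", OF per grid_inverse] row_less col_less by blast
  also have "\<dots> \<longleftrightarrow> (\<forall>j<N. ?P (int 0 - int j * int r)) \<and>
      (\<forall>i\<in>{1..<d}. \<forall>j<N. ?P (int i - int j * int r))"
    using d by (metis One_nat_def atLeastLessThan_iff less_one not_less)
  also have "(\<forall>j<N. ?P (int 0 - int j * int r)) \<longleftrightarrow> ?P (int 0 - int 0 * int r) \<and>
      (\<forall>j\<in>{1..<N}. ?P (int 0 - int j * int r))"
    using N by (metis One_nat_def atLeastLessThan_iff less_one not_less)
  also have "?P (int 0 - int 0 * int r) \<longleftrightarrow> ?O"
    using row0[OF N] by (simp add: eval_nat_numeral algebra_simps)
  also have "(\<forall>j\<in>{1..<N}. ?P (int 0 - int j * int r)) \<longleftrightarrow> ?R"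
    by (intro ball_cong refl, subst row0) auto
  also have "(\<forall>i\<in>{1..<d}. \<forall>j<N. ?P (int i - int j * int r)) \<longleftrightarrow> ?I"
  proof (intro ball_cong refl)
    fix i assume i: "i \<in> {1..<d}"
    show "(\<forall>j<N. ?P (int i - int j * int r)) \<longleftrightarrow>
        (\<forall>j\<in>{0..<N}. 2 * cyc_entry C i j - cyc_entry C (i - 1) j
          = cyc_entry A i (j + 2) - cyc_entry A i (j + 1) + cyc_entry A i j)"
      using rows[OF i] by (metis atLeastLessThan_iff zero_le)
  qed
  finally show ?thesis by (simp only: conj_assoc)
qed

lemma is_carry_matrix_iff:
  assumes A: "A \<in> carrier_mat d N"
  shows "is_carry_matrix d N e A C \<longleftrightarrow>
    C \<in> carrier_mat d N \<and> elements_mat C \<subseteq> {-1, 0, 1} \<and>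
    (\<forall>z. 2 * unroll C z - unroll C (z - 1) = carry_target A z)"
  using carry_equations_iff[OF A, of C] unfolding is_carry_matrix_def by argo

section \<open>Uniqueness and existence of the carry matrix\<close>

lemma cyc_sum_unroll_carry:
  assumes "\<And>z. 2 * unroll C z - unroll C (z - 1) = carry_target A z"
  shows "(2 ^ n - 1) * unroll C z = cyc_sum n (carry_target A) (z + 1)"
  using carry_unique[of "unroll C" n "carry_target A" z] unroll_period assms by simp

lemma carry_matrix_unique:
  assumes A: "A \<in> carrier_mat d N"
    and C: "is_carry_matrix d N e A C" and C': "is_carry_matrix d N e A C'"
  shows "C = C'"
proof -
  have "(2 ^ n - 1) * unroll C z = (2 ^ n - 1) * unroll C' z" for z
    using C C' cyc_sum_unroll_carry[of C A z] cyc_sum_unroll_carry[of C' A z]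
    by (simp add: is_carry_matrix_iff[OF A])
  moreover have "(2 ^ n - 1 :: int) \<noteq> 0"
    using n_pos by simp
  ultimately have "unroll C = unroll C'"
    by (simp add: fun_eq_iff)
  then show ?thesis
    using C C' unroll_inject by (simp add: is_carry_matrix_iff[OF A])
qed

lemma carry_matrix_exists_iff:
  assumes A: "A \<in> carrier_mat d N" and bits: "\<And>z. unroll A z \<in> {0, 1}" and "n > 1"
  shows "(\<exists>C. is_carry_matrix d N e A C) \<longleftrightarrow> 2 ^ n - 1 dvd cyc_sum n (carry_target A) 0"
proof
  assume "\<exists>C. is_carry_matrix d N e A C"
  then obtain C where "is_carry_matrix d N e A C" ..
  \<comment> \<open>Position -1 is chosen because its sum starts at 0.\<close>
  then have "(2 ^ n - 1) * unroll C (- 1) = cyc_sum n (carry_target A) 0"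
    using cyc_sum_unroll_carry[of C A "- 1"] by (simp add: is_carry_matrix_iff[OF A])
  then show "2 ^ n - 1 dvd cyc_sum n (carry_target A) 0"
    by (metis dvd_triv_left)
next
  assume dvd: "2 ^ n - 1 dvd cyc_sum n (carry_target A) 0"
  let ?t = "carry_target A"
  obtain c where c: "\<And>z. c (z + int n) = c z" "\<And>z. 2 * c z - c (z - 1) = ?t z"
    and val: "\<And>z. (2 ^ n - 1) * c z = cyc_sum n ?t (z + 1)"
    using carry_exists[OF n_pos, of ?t, OF carry_target_period dvd] by metis
  have "unroll A z = 0 \<or> unroll A z = 1" for z
    using bits by blast
  then have b: "0 \<le> unroll A z" "unroll A z \<le> 1" for z
    by (metis order_refl zero_le_one)+
  have t: "-2 \<le> ?t z" "?t z \<le> 2" for z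
    using b[of z] b[of "z - int r"] b[of "z - int (2 * r)"]
    by (auto simp: carry_target_def of_bool_def)
  \<comment> \<open>At position 0 the indicator lowers the maximum to 1.\<close>
  have "?t 0 < 2"
    using b[of 0] b[of "0 - int r"] b[of "0 - int (2 * r)"] by (simp add: carry_target_def)
  \<comment> \<open>For \<open>n > 1\<close> the indicator vanishes at position 1, so the minimum
    there is -1.\<close>
  moreover have "-2 < ?t 1"
    using b[of 1] b[of "1 - int r"] b[of "1 - int (2 * r)"] \<open>n > 1\<close>
    by (simp add: carry_target_def)
  ultimately have "(2 ^ n - 1) * c z < (2 ^ n - 1) * 2" "(2 ^ n - 1) * (-2) < (2 ^ n - 1) * c z" for z
    using cyc_sum_less[of ?t 2 0 n "z + 1"] cyc_sum_greater[of "-2" ?t 1 n "z + 1"]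
      t n_pos carry_target_period val[of z]
    by (simp_all only: mult.commute)
  moreover have "(2 ^ n - 1 :: int) > 0"
    using n_pos by simp
  ultimately have "c z < 2" "-2 < c z" for z
    by (metis mult_less_cancel_left_pos)+
  then have range: "c z \<in> {-1, 0, 1}" for z
    by (smt (verit) insert_iff)
  have "elements_mat (roll c) \<subseteq> {-1, 0, 1}"
    using range by (auto simp: elements_mat_def roll_def)
  then have "is_carry_matrix d N e A (roll c)"
    using c by (simp add: is_carry_matrix_iff[OF A] roll_carrier unroll_roll)
  then show "\<exists>C. is_carry_matrix d N e A C" ..
qed

section \<open>Link with the Kasami exponent\<close>

text \<open>Shifting by \<open>2 * r\<close> and by \<open>r\<close> multiplies the digit sum by
  \<open>2 ^ (2 * r)\<close> and \<open>2 ^ r\<close>, which assembles the factor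
  \<open>kasami_exponent r\<close>.\<close>

lemma cyc_sum_carry_target:
  "[cyc_sum n (carry_target A) 0 = cyc_sum n (unroll A) 0 * kasami_exponent r - 1] (mod 2 ^ n - 1)"
proof -
  let ?S = "cyc_sum n (unroll A)"
  \<comment> \<open>In the window from 0 only \<open>m = 0\<close> is a multiple of
    \<open>n\<close>, so the indicator contributes exactly 1.\<close>
  have "(\<Sum>m<n. of_bool (int n dvd int m) * 2 ^ m) = (\<Sum>m\<in>{0}. 2 ^ m :: int)"
    using n_pos by (intro sum.mono_neutral_cong_right) (auto dest: dvd_imp_le)
  then have "cyc_sum n (carry_target A) 0 = ?S (0 - int (2 * r)) - ?S (0 - int r) + ?S 0 - 1"
    by (simp add: cyc_sum_def carry_target_def sum.distrib sum_subtractf algebra_simps)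
  also have "[\<dots> = 2 ^ (2 * r) * ?S 0 - 2 ^ r * ?S 0 + ?S 0 - 1] (mod 2 ^ n - 1)"
    by (intro cong_add cong_diff cong_refl cyc_sum_shift_cong unroll_period)
  finally show ?thesis
    by (simp add: kasami_exponent_def algebra_simps)
qed

text \<open>The cells correspond bijectively to the exponents below \<open>n\<close>, with row and
  column of \<open>m\<close> as the inverse map.\<close>

lemma sum_grid:
  "(\<Sum>i = 0..<d. \<Sum>j = 0..<N. f (exp_res n (int i - int j * int r))) = (\<Sum>m<n. f m)"
proof -
  have res: "[int (exp_res n z) = z] (mod int n)" for z
    using n_pos by (simp add: exp_res_def cong_def)
  have "(\<Sum>i = 0..<d. \<Sum>j = 0..<N. f (exp_res n (int i - int j * int r))) =
    (\<Sum>(i, j)\<in>{0..<d} \<times> {0..<N}. f (exp_res n (int i - int j * int r)))"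
    by (rule sum.cartesian_product)
  also have "\<dots> = (\<Sum>m<n. f m)"
  proof (rule sum.reindex_bij_witness[of _ "\<lambda>m. (nat (int m mod int d), col (int m))"
        "\<lambda>(i, j). exp_res n (int i - int j * int r)"])
    fix p assume "p \<in> {0..<d} \<times> {0..<N}"
    then obtain i j where p: "p = (i, j)" "i < d" "j < N" by auto
    have "nat (int (exp_res n z) mod int d) = nat (z mod int d)"
      "col (int (exp_res n z)) = col z" for z
      by (rule row_cong[OF res], rule col_cong[OF res])
    then show "(\<lambda>m. (nat (int m mod int d), col (int m)))
        ((\<lambda>(i, j). exp_res n (int i - int j * int r)) p) = p"
      using p grid_row grid_col by simp
    show "(\<lambda>(i, j). exp_res n (int i - int j * int r)) p \<in> {..<n}"
      using n_pos by (simp add: p exp_res_def nat_less_iff)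
  next
    fix m assume m: "m \<in> {..<n}"
    have "exp_res n (int (nat (int m mod int d)) - int (col (int m)) * int r) = m"
      using grid_inverse[of "int m"] m by (simp add: exp_res_def cong_def)
    then show "(\<lambda>(i, j). exp_res n (int i - int j * int r))
        (nat (int m mod int d), col (int m)) = m"
      by simp
    show "(nat (int m mod int d), col (int m)) \<in> {0..<d} \<times> {0..<N}"
      using row_less col_less by simp
  qed auto
  finally show ?thesis .
qed

end

section \<open>Modular inverses and conclusion\<close>

lemma least_pos_inverse_cong:
  assumes "coprime x m" "m > 0"
  shows "[x * least_pos_inverse x m = 1] (mod m)"
proof -
  obtain y where y: "[x * y = 1] (mod m)"
    using assms(1) cong_solve_coprime_nat by fastforce
  \<comment> \<open>The solution \<open>y\<close> may be 0; adding \<open>m\<close> makes it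
    positive, so the \<open>LEAST\<close> ranges over a nonempty set.\<close>
  then have "[x * (y + m) = 1] (mod m)"
    by (simp add: cong_def distrib_left)
  then have "\<exists>y. 0 < y \<and> [x * y = 1] (mod m)"
    using assms(2) by (intro exI[of _ "y + m"]) simp
  then show ?thesis
    unfolding least_pos_inverse_def by (rule LeastI2_ex) simp
qed

theorem theorem7:
  fixes n r d e a :: nat and \<alpha> :: "nat \<Rightarrow> int" and A :: "int mat"
  assumes "n > 0" and "r > 0"
    and "d = gcd r n"
    and "e = least_pos_inverse (r div d) (n div d)"
    and "a \<in> {1..2 ^ n - 2}"
    and "\<And>m. m < n \<Longrightarrow> \<alpha> m \<in> {0, 1}"
    and "int a = (\<Sum>m = 0..<n. \<alpha> m * 2 ^ m)"
    and "A = digit_matrix n r \<alpha>"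
  shows "[int a = (\<Sum>i = 0..<d. \<Sum>j = 0..<n div d.
            A $$ (i, j) * 2 ^ exp_res n (int i - int j * int r))] (mod 2 ^ n - 1)
    \<and> ([int a * kasami_exponent r = 1] (mod 2 ^ n - 1)
         \<longleftrightarrow> (\<exists>C. is_carry_matrix d (n div d) e A C))
    \<and> (\<forall>C C'. is_carry_matrix d (n div d) e A C \<longrightarrow> is_carry_matrix d (n div d) e A C' \<longrightarrow> C = C')"
proof -
  define N where "N = n div d"
  have d: "d > 0" "n = d * N" "r = d * (r div d)"
    using assms(1,3) by (simp_all add: N_def)
  then have N: "N > 0"
    using assms(1) by (metis gr0I mult_0_right)
  have "coprime (r div d) N"
    using assms(1) by (simp add: N_def assms(3) div_gcd_coprime)
  then have "[(r div d) * e = 1] (mod N)"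
    using least_pos_inverse_cong N by (simp add: assms(4) N_def)
  then have "[int (r div d) * int e = 1] (mod int N)"
    by (metis cong_int_iff of_nat_1 of_nat_mult)
  then interpret cyclic_grid n r d N "r div d" e
    using d N by unfold_locales
  \<comment> \<open>For \<open>n = 1\<close> the range of \<open>a\<close> would be empty.\<close>
  have "n > 1"
    using assms(1,5) by (cases "n = 1") auto
  have A: "A = roll (\<lambda>z. \<alpha> (exp_res n z))"
    by (simp only: assms(8) digit_matrix_def roll_def flip: assms(3) N_def)
  have unroll: "unroll A z = \<alpha> (exp_res n z)" for z
    unfolding A by (rule unroll_roll) (simp add: exp_res_def)
  have carrier: "A \<in> carrier_mat d N"
    by (simp add: A roll_carrier)
  have bits: "unroll A z \<in> {0, 1}" for z
    unfolding unroll using assms(1) by (intro assms(6)) (simp add: exp_res_def nat_less_iff)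
  have a: "cyc_sum n (unroll A) 0 = int a"
    by (simp add: cyc_sum_def unroll exp_res_def assms(7) lessThan_atLeast0)
  \<comment> \<open>With reduced exponents the claimed congruence is even an equality.\<close>
  have "(\<Sum>i = 0..<d. \<Sum>j = 0..<N. A $$ (i, j) * 2 ^ exp_res n (int i - int j * int r)) = int a"
    using sum_grid[of "\<lambda>m. \<alpha> m * 2 ^ m"]
    by (simp add: A roll_def assms(7) lessThan_atLeast0)
  moreover have "[int a * kasami_exponent r = 1] (mod 2 ^ n - 1) \<longleftrightarrow>
      (\<exists>C. is_carry_matrix d N e A C)"
    \<comment> \<open>The carry sum is divisible by \<open>2 ^ n - 1\<close> iff
      \<open>a * kasami_exponent r - 1\<close> is, which is the inverse condition.\<close>
    using cong_dvd_iff[OF cyc_sum_carry_target[of A, unfolded a]]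
    unfolding carry_matrix_exists_iff[OF carrier bits \<open>n > 1\<close>]
    by (simp only: cong_iff_dvd_diff)
  ultimately show ?thesis
    using carry_matrix_unique[OF carrier] by (auto simp flip: N_def)
qed

end
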